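(* Let $G$ be a minimal $(k,3)$-cage (that is, the complete graph $K_{k+1}$). The distance spectrum of the subdivision graph $S(G)$ is $$\Big\{k^2\pm\sqrt{\tfrac12k(k^2+1)(2k+1)},\ (-2k)^{(k)},\ 0^{\left(\binom{k+1}{2}-1\right)}\Big\}.$$
   Context: All graphs are finite, simple, connected and undirected. The distance matrix $D(H)$ of a graph $H$ has $(i,j)$ entry equal to the graph distance between the $i$-th and $j$-th vertices; the distance spectrum of $H$ is the multiset of eigenvalues of $D(H)$, and $\theta^{(m)}$ denotes the eigenvalue $\theta$ with multiplicity $m$ (multiplicity $1$ if no superscript is shown). The subdivision graph $S(G)$ is obtained from $G$ by inserting a new vertex of degree $2$ on each edge of $G$. A $(k,g)$-cage is a $k$-regular simple graph of girth $g$ with the minimum possible number of vertices; a minimal $(k,g)$-cage is one attaining the Moore bound. For $g=3$ (so $k\ge2$) these are exactly the complete graphs $K_{k+1}$. *)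

theory Defs
  imports
    "Graph_Theory.Graph_Theory"
    "Jordan_Normal_Form.Char_Poly"
    "HOL-Library.Extended_Nat"
begin

(* Finite simple undirected graphs are the symmetric loop-free finite digraphs
   pair_graph, in which an edge uv is the pair of arcs (u,v), (v,u). *)
definition simple_connected_graph :: "'a pair_pre_digraph \<Rightarrow> bool" where
  "simple_connected_graph G \<longleftrightarrow> pair_graph G \<and> connected (with_proj G)"

(* Every edge contributes exactly one arc leaving v, so out_degree is the degree of v. *)
definition regular_graph :: "nat \<Rightarrow> 'a pair_pre_digraph \<Rightarrow> bool" where
  "regular_graph k G \<longleftrightarrow> (\<forall>v \<in> pverts G. out_degree (with_proj G) v = k)"

(* pre_digraph.cycle also counts the closed walk u,v,u along a single edge, which is
   no cycle of the undirected graph; hence the length restriction.  Acyclic graphs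
   have infinite girth. *)
definition girth :: "'a pair_pre_digraph \<Rightarrow> enat" where
  "girth G = (INF p \<in> {p. pre_digraph.cycle (with_proj G) p \<and> 3 \<le> length p}. enat (length p))"

definition regular_of_girth :: "nat \<Rightarrow> nat \<Rightarrow> 'a pair_pre_digraph \<Rightarrow> bool" where
  "regular_of_girth k g G \<longleftrightarrow> simple_connected_graph G \<and> regular_graph k G \<and> girth G = enat g"

(* Every finite graph is isomorphic to one whose vertices are natural numbers, so
   comparing with graphs on nat is no restriction. *)
definition cage :: "nat \<Rightarrow> nat \<Rightarrow> 'a pair_pre_digraph \<Rightarrow> bool" where
  "cage k g G \<longleftrightarrow> regular_of_girth k g G \<and>
     (\<forall>H :: nat pair_pre_digraph. regular_of_girth k g H \<longrightarrow> card (pverts G) \<le> card (pverts H))"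

(* For g = 2d + 1 count the vertices at distance at most d from a vertex, for g = 2d
   those at distance at most d - 1 from one of the two ends of an edge. *)
definition moore_bound :: "nat \<Rightarrow> nat \<Rightarrow> nat" where
  "moore_bound k g =
     (if odd g then 1 + k * (\<Sum>i < g div 2. (k - 1) ^ i)
      else 2 * (\<Sum>i < g div 2. (k - 1) ^ i))"

definition minimal_cage :: "nat \<Rightarrow> nat \<Rightarrow> 'a pair_pre_digraph \<Rightarrow> bool" where
  "minimal_cage k g G \<longleftrightarrow> cage k g G \<and> card (pverts G) = moore_bound k g"

lemma girth_ge3: "girth G \<ge> 3"
  unfolding girth_def by (rule INF_greatest) (auto simp: numeral_eq_enat)

lemma neighbours_regular:
  assumes "pair_graph G" "regular_graph k G" "v \<in> pverts G"
  shows "card {w. (v,w) \<in> parcs G} = k" "{w. (v,w) \<in> parcs G} \<subseteq> pverts G - {v}"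
proof -
  interpret pair_graph G by fact
  have "out_arcs (with_proj G) v = Pair v ` {w. (v,w) \<in> parcs G}"
    by (auto simp: out_arcs_def)
  then show "card {w. (v,w) \<in> parcs G} = k"
    using assms unfolding regular_graph_def out_degree_def by (auto simp: card_image inj_on_def)
  show "{w. (v,w) \<in> parcs G} \<subseteq> pverts G - {v}"
    using no_loops' by (auto dest: arc_snd_in_verts[of "(v,_)", simplified])
qed

lemma minimal_cage_3_imp_complete:
  assumes "minimal_cage k 3 G"
  shows "2 \<le> k" "complete_digraph (k + 1) (with_proj G)"
proof -
  have *: "pair_graph G" "regular_graph k G" and g: "girth G = 3" and c: "card (pverts G) = k + 1"
    using assms unfolding minimal_cage_def cage_def regular_of_girth_def simple_connected_graph_def
    by (auto simp: moore_bound_def numeral_eq_enat numeral_3_eq_3)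
  interpret pair_graph G by fact
  have "{w. (v,w) \<in> parcs G} = pverts G - {v}" if "v \<in> pverts G" for v
    using neighbours_regular[OF * that] c that pair_finite_verts by (intro card_subset_eq) auto
  then show "complete_digraph (k + 1) (with_proj G)"
    unfolding complete_digraph_pair_def using c pair_finite_verts arc_fst_in_verts by (auto; force)
  have "\<exists>p. cycle p \<and> 3 \<le> length p"
  proof (rule ccontr)
    assume "\<not> ?thesis"
    then have "girth G = Inf {}" unfolding girth_def by (intro arg_cong[of _ _ Inf]) auto
    then show False using g by (simp add: Inf_enat_def)
  qed
  then obtain p u where p: "awalk u p u" "distinct (tl (pawalk_verts u p))" "3 \<le> length p"
    unfolding cycle_def by auto
  have "length (pawalk_verts u p) = length p + 1"
    by (induct p arbitrary: u) auto
  moreover have "set (pawalk_verts u p) \<subseteq> pverts G" using p(1) by auto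
  ultimately have "3 \<le> card (pverts G)"
    using p(2,3) distinct_card[of "tl (pawalk_verts u p)"] pair_finite_verts
    by (smt (verit) card_mono length_tl diff_add_inverse2 subset_trans list.set_sel(2) subsetI le_trans list.sel(2))
  then show "2 \<le> k" using c by simp
qed

lemma complete_imp_minimal_cage_3:
  assumes "2 \<le> k" "complete_digraph (k + 1) (with_proj G)"
  shows "minimal_cage k 3 G"
proof -
  have K: "finite (pverts G)" "card (pverts G) = k + 1"
    "parcs G = {(u,v). (u,v) \<in> (pverts G \<times> pverts G) \<and> u \<noteq> v}"
    using assms(2) unfolding complete_digraph_pair_def by auto
  interpret pair_graph G using assms(2) by (rule pair_graphI_complete)
  have "out_arcs (with_proj G) v = Pair v ` (pverts G - {v})" if "v \<in> pverts G" for v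
    using that K(3) by (auto simp: out_arcs_def)
  then have reg: "regular_graph k G"
    using K unfolding regular_graph_def out_degree_def by (auto simp: card_image inj_on_def)
  have conn: "connected (with_proj G)"
  proof -
    have "strongly_connected (with_proj G)"
    proof (rule strongly_connectedI)
      show "verts (with_proj G) \<noteq> {}" using K by auto
      fix u v assume "u \<in> verts (with_proj G)" "v \<in> verts (with_proj G)"
      then show "u \<rightarrow>\<^sup>*\<^bsub>with_proj G\<^esub> v"
        by (cases "u = v") (auto intro!: reachable_adjI simp: K)
    qed
    then show ?thesis unfolding connected_def strongly_connected_def
      using reachable_mk_symmetricI by simp
  qed
  obtain a b c where abc: "a \<in> pverts G" "b \<in> pverts G" "c \<in> pverts G" "a \<noteq> b" "b \<noteq> c" "a \<noteq> c"
  proof -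
    have "3 \<le> card (pverts G)" using K assms by simp
    then obtain T where "T \<subseteq> pverts G" "card T = 3" by (metis obtain_subset_with_card_n)
    then show ?thesis using that by (auto simp: card_3_iff)
  qed
  have "cycle [(a,b),(b,c),(c,a)]"
    unfolding cycle_def awalk_def using abc K by (intro exI[of _ a]) auto
  then have "girth G \<le> enat (length [(a,b),(b,c),(c,a)])"
    unfolding girth_def by (intro INF_lower) auto
  then have girth: "girth G = enat 3"
    using girth_ge3[of G] by (simp add: numeral_eq_enat numeral_3_eq_3)
  have "k + 1 \<le> card (pverts H)" if H: "regular_of_girth k 3 H" for H :: "nat pair_pre_digraph"
  proof -
    have h: "pair_graph H" "regular_graph k H" "connected (with_proj H)"
      using H unfolding regular_of_girth_def simple_connected_graph_def by auto
    interpret H: pair_graph H by fact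
    obtain v where v: "v \<in> pverts H"
      using h(3) unfolding connected_def strongly_connected_def by auto
    have "k \<le> card (pverts H - {v})"
      using neighbours_regular[OF h(1,2) v] H.pair_finite_verts by (metis card_mono finite_Diff)
    then show ?thesis using v H.pair_finite_verts
      by (metis Suc_eq_plus1 Suc_le_mono card_Suc_Diff1)
  qed
  then show ?thesis unfolding minimal_cage_def cage_def regular_of_girth_def simple_connected_graph_def
    using reg conn girth K pair_graph by (auto simp: moore_bound_def numeral_3_eq_3)
qed

lemma minimal_cage_3_iff_complete:
  "minimal_cage k 3 G \<longleftrightarrow> 2 \<le> k \<and> complete_digraph (k + 1) (with_proj G)"
  using minimal_cage_3_imp_complete complete_imp_minimal_cage_3 by blast

(* Inl v is an old vertex, Inr {u,v} the new vertex on the edge uv.  As parcs G is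
   symmetric, Inr {u,v} becomes adjacent to both Inl u and Inl v. *)
definition subdivision_graph :: "'a pair_pre_digraph \<Rightarrow> ('a + 'a set) pair_pre_digraph" where
  "subdivision_graph G =
     \<lparr> pverts = Inl ` pverts G \<union> {Inr {u, v} | u v. (u, v) \<in> parcs G},
       parcs = {(Inl u, Inr {u, v}) | u v. (u, v) \<in> parcs G} \<union>
               {(Inr {u, v}, Inl u) | u v. (u, v) \<in> parcs G} \<rparr>"

lemma pair_graph_subdivision_graph:
  assumes "pair_graph G" shows "pair_graph (subdivision_graph G)"
proof -
  interpret pair_graph G by fact
  have "finite {Inr {u, v} :: 'a + 'a set | u v. (u, v) \<in> parcs G}"
    by (rule finite_subset[of _ "(\<lambda>(u,v). Inr {u,v}) ` parcs G"]) auto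
  moreover have "finite {(Inl u, Inr {u, v}) :: ('a + 'a set) \<times> _ | u v. (u, v) \<in> parcs G}"
    by (rule finite_subset[of _ "(\<lambda>(u,v). (Inl u, Inr {u,v})) ` parcs G"]) auto
  moreover have "finite {(Inr {u, v}, Inl u) :: ('a + 'a set) \<times> _ | u v. (u, v) \<in> parcs G}"
    by (rule finite_subset[of _ "(\<lambda>(u,v). (Inr {u,v}, Inl u)) ` parcs G"]) auto
  moreover have "\<And>u v. (u,v) \<in> parcs G \<Longrightarrow> u \<in> pverts G" using arc_fst_in_verts by fastforce
  ultimately show ?thesis
    by unfold_locales (auto simp: subdivision_graph_def symmetric_def sym_def)
qed

definition graph_dist :: "'a pair_pre_digraph \<Rightarrow> 'a \<Rightarrow> 'a \<Rightarrow> real" where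
  "graph_dist H u v = real_of_ereal (wf_digraph.\<mu> (with_proj H) (\<lambda>_. 1) u v)"

(* The list vs enumerates the vertices of H. *)
definition distance_matrix :: "'a pair_pre_digraph \<Rightarrow> 'a list \<Rightarrow> real mat" where
  "distance_matrix H vs =
     mat (length vs) (length vs) (\<lambda>(i, j). graph_dist H (vs ! i) (vs ! j))"

(* Eigenvalues with algebraic multiplicity; a distance matrix is real symmetric, so
   all complex roots of its characteristic polynomial are real. *)
definition eigenvalue_mset :: "real mat \<Rightarrow> real multiset" where
  "eigenvalue_mset A = proots (char_poly A)"

end

theory Submission
  imports Defs
begin

text \<open>
  The vertices of the subdivision of the complete graph on \<open>V\<close>, where \<open>card V = k + 1\<close>, are the subsets
  of \<open>V\<close> with one or two elements, and the distance of two of them is the size of their symmetric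
  difference, \<open>card x + card y - 2 * card (x \<inter> y)\<close>. Hence the distance matrix has rank at most
  \<open>k + 2\<close>: it is a product \<open>U * W\<close>, where \<open>W\<close> consists of the indicator vectors of the subsets
  and one more row of ones.  By the identity
  \<open>x ^ n * det (x - U * W) = x ^ m * det (x - W * U)\<close> it suffices to treat \<open>W * U\<close>. This matrix is
  \<open>- 2 * k\<close> times the identity plus a matrix \<open>X * Y\<close> of rank two, so the same identity reduces the
  computation to a determinant of size two.
\<close>

section \<open>Determinants and characteristic polynomials\<close>

text \<open>Both sides compute \<open>x ^ n * det ?B\<close>: block elimination from the right
  leaves the Schur complement \<open>x - U * V\<close>, elimination from the left leaves
  \<open>x - V * U\<close>.\<close>

lemma det_smult_one_minus_mult_swap:
  fixes U V :: "'a :: idom mat"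
  assumes U: "U \<in> carrier_mat m n" and V: "V \<in> carrier_mat n m"
  shows "x ^ n * det (x \<cdot>\<^sub>m 1\<^sub>m m - U * V) = x ^ m * det (x \<cdot>\<^sub>m 1\<^sub>m n - V * U)"
proof -
  let ?B = "four_block_mat (x \<cdot>\<^sub>m 1\<^sub>m m) U V (1\<^sub>m n)"
  have B: "?B \<in> carrier_mat (m + n) (m + n)"
    by simp
  have carr: "x \<cdot>\<^sub>m 1\<^sub>m m - U * V \<in> carrier_mat m m" "x \<cdot>\<^sub>m 1\<^sub>m n - V * U \<in> carrier_mat n n"
    using U V by (auto intro!: minus_carrier_mat)
  have "?B * four_block_mat (1\<^sub>m m) (0\<^sub>m m n) (- V) (1\<^sub>m n) =
      four_block_mat (x \<cdot>\<^sub>m 1\<^sub>m m * 1\<^sub>m m + U * (- V)) (x \<cdot>\<^sub>m 1\<^sub>m m * 0\<^sub>m m n + U * 1\<^sub>m n)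
        (V * 1\<^sub>m m + 1\<^sub>m n * (- V)) (V * 0\<^sub>m m n + 1\<^sub>m n * 1\<^sub>m n)"
    using U V by (intro mult_four_block_mat) auto
  also have "\<dots> = four_block_mat (x \<cdot>\<^sub>m 1\<^sub>m m - U * V) U (0\<^sub>m n m) (1\<^sub>m n)"
    using U V by (intro cong_four_block_mat) (auto simp: minus_add_uminus_mat[of _ m m])
  finally have "det ?B * det (four_block_mat (1\<^sub>m m) (0\<^sub>m m n) (- V) (1\<^sub>m n)) =
      det (four_block_mat (x \<cdot>\<^sub>m 1\<^sub>m m - U * V) U (0\<^sub>m n m) (1\<^sub>m n))"
    using det_mult[OF B, of "four_block_mat (1\<^sub>m m) (0\<^sub>m m n) (- V) (1\<^sub>m n)"] V by simp
  then have 1: "det ?B = det (x \<cdot>\<^sub>m 1\<^sub>m m - U * V)"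
    using U V carr by (simp add: det_four_block_mat_upper_right_zero[of _ m _ n]
        det_four_block_mat_lower_left_zero[of _ m _ n])
  \<comment> \<open>The lower right block \<open>x\<close> of the left factor avoids a division by
    \<open>x\<close>, so \<open>x = 0\<close> is covered too. It is the source of the factor
    \<open>x ^ n\<close>.\<close>
  have "four_block_mat (1\<^sub>m m) (0\<^sub>m m n) (- V) (x \<cdot>\<^sub>m 1\<^sub>m n) * ?B =
      four_block_mat (1\<^sub>m m * (x \<cdot>\<^sub>m 1\<^sub>m m) + 0\<^sub>m m n * V) (1\<^sub>m m * U + 0\<^sub>m m n * 1\<^sub>m n)
        ((- V) * (x \<cdot>\<^sub>m 1\<^sub>m m) + (x \<cdot>\<^sub>m 1\<^sub>m n) * V) ((- V) * U + (x \<cdot>\<^sub>m 1\<^sub>m n) * 1\<^sub>m n)"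
    using U V by (intro mult_four_block_mat) auto
  also have "\<dots> = four_block_mat (x \<cdot>\<^sub>m 1\<^sub>m m) U (0\<^sub>m n m) (x \<cdot>\<^sub>m 1\<^sub>m n - V * U)"
  proof (intro cong_four_block_mat)
    show "(- V) * (x \<cdot>\<^sub>m 1\<^sub>m m) + (x \<cdot>\<^sub>m 1\<^sub>m n) * V = 0\<^sub>m n m"
      using V by (intro eq_matI) (auto simp: mult_smult_distrib[of _ n m _ m] mult_smult_assoc_mat[of _ n n _ m])
    show "(- V) * U + (x \<cdot>\<^sub>m 1\<^sub>m n) * 1\<^sub>m n = x \<cdot>\<^sub>m 1\<^sub>m n - V * U"
      using U V by (intro eq_matI) auto
  qed (use U V in auto)
  finally have "det (four_block_mat (1\<^sub>m m) (0\<^sub>m m n) (- V) (x \<cdot>\<^sub>m 1\<^sub>m n)) * det ?B =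
      det (four_block_mat (x \<cdot>\<^sub>m 1\<^sub>m m) U (0\<^sub>m n m) (x \<cdot>\<^sub>m 1\<^sub>m n - V * U))"
    using det_mult[OF _ B, of "four_block_mat (1\<^sub>m m) (0\<^sub>m m n) (- V) (x \<cdot>\<^sub>m 1\<^sub>m n)"] V by simp
  then have "x ^ n * det ?B = x ^ m * det (x \<cdot>\<^sub>m 1\<^sub>m n - V * U)"
    using U V carr by (simp add: det_four_block_mat_upper_right_zero[of _ m _ n]
        det_four_block_mat_lower_left_zero[of _ m _ n])
  with 1 show ?thesis by simp
qed

lemma det_mat_2:
  assumes "A \<in> carrier_mat 2 2"
  shows "det A = A $$ (0,0) * A $$ (1,1) - A $$ (0,1) * A $$ (1,0)"
proof -
  have "det (mat_delete A i 0) = mat_delete A i 0 $$ (0,0)" for i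
    using assms by (intro det_single) (auto simp: mat_delete_def)
  then show ?thesis
    using assms
    by (subst laplace_expansion_column[of _ 2 0])
       (auto simp: numeral_2_eq_2 cofactor_def mat_delete_def algebra_simps)
qed

text \<open>Evaluation at a scalar turns the characteristic polynomial into a determinant to which
  \<open>det_smult_one_minus_mult_swap\<close> applies.\<close>

lemma poly_char_poly:
  fixes A :: "'a :: field mat"
  assumes A: "A \<in> carrier_mat n n"
  shows "poly (char_poly A) x = det (x \<cdot>\<^sub>m 1\<^sub>m n - A)"
proof -
  have "- char_matrix A x = x \<cdot>\<^sub>m 1\<^sub>m n - A"
    using A by (intro eq_matI) (auto simp: char_matrix_def)
  then show ?thesis
    using char_poly_matrix[OF A] by simp
qed

section \<open>Distances in the subdivision as sizes of symmetric differences\<close>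

lemma card_sym_diff_eq:
  assumes "finite X" "finite Y"
  shows "real (card (sym_diff X Y)) = real (card X) + real (card Y) - 2 * real (card (X \<inter> Y))"
proof -
  have "card (sym_diff X Y) = card (X - Y) + card (Y - X)"
    using assms by (intro card_Un_disjoint) auto
  moreover have "card A = card (A - B) + card (A \<inter> B)" if "finite A" for A B :: "'a set"
    using that by (subst card_Un_disjoint[symmetric]) (auto intro: arg_cong[of _ _ card])
  from this[OF assms(1), of Y] this[OF assms(2), of X]
  have "card X = card (X - Y) + card (X \<inter> Y)" "card Y = card (Y - X) + card (X \<inter> Y)"
    by (simp_all add: Int_commute)
  ultimately show ?thesis by simp
qed

text \<open>With unit costs \<open>\<mu>\<close> is the infimum of the walk lengths. A walk that
  attains a lower bound makes it finite, so the conversion from the extended reals is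
  faithful.\<close>

lemma graph_dist_eqI:
  assumes "pair_graph H" and walk: "pre_digraph.awalk (with_proj H) x p y" "length p = d"
    and low: "\<And>q. pre_digraph.awalk (with_proj H) x q y \<Longrightarrow> d \<le> length q"
  shows "graph_dist H x y = real d"
proof -
  interpret pair_graph H by fact
  have cost: "awalk_cost (\<lambda>_. 1) q = real (length q)" for q
    by (induction q) auto
  have "\<mu> (\<lambda>_. 1) x y = ereal (real d)"
    unfolding \<mu>_def cost
  proof (rule antisym)
    show "(INF q\<in>{q. awalk x q y}. ereal (real (length q))) \<le> ereal (real d)"
      using walk by (intro INF_lower2[of p]) auto
    show "ereal (real d) \<le> (INF q\<in>{q. awalk x q y}. ereal (real (length q)))"
      using low by (intro INF_greatest) auto
  qed
  then show ?thesis by (simp add: graph_dist_def)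
qed

text \<open>Identifies the vertices of the subdivision with the subsets of \<open>V\<close> of size
  one or two; adjacency becomes proper inclusion.\<close>

fun vertex_set :: "'a + 'a set \<Rightarrow> 'a set" where
  "vertex_set (Inl v) = {v}"
| "vertex_set (Inr e) = e"

locale complete_subdivision =
  fixes G :: "'a pair_pre_digraph" and k :: nat
  assumes k: "2 \<le> k" and complete: "complete_digraph (k + 1) (with_proj G)"
begin

abbreviation "S \<equiv> subdivision_graph G"
abbreviation "V \<equiv> pverts G"

definition edges :: "'a set set" where
  "edges = {e. e \<subseteq> V \<and> card e = 2}"

lemma finite_V: "finite V" and card_V: "card V = k + 1"
  and arcs_G: "parcs G = {(u,v). u \<in> V \<and> v \<in> V \<and> u \<noteq> v}"
  using complete unfolding complete_digraph_pair_def by auto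

lemma finite_edges: "finite edges"
  using finite_V unfolding edges_def by simp

lemma card_edges: "card edges = (k + 1) choose 2"
  using n_subsets[OF finite_V, of 2] card_V unfolding edges_def by simp

lemma pair_graph_S: "pair_graph S"
  by (rule pair_graph_subdivision_graph, rule pair_graphI_complete, rule complete)

lemma verts_S: "pverts S = Inl ` V \<union> Inr ` edges"
proof -
  have "{Inr {u, v} | u v. (u, v) \<in> parcs G} = (Inr ` edges :: ('a + 'a set) set)" (is "?L = ?R")
  proof
    have "{u, v} \<in> edges" if "(u, v) \<in> parcs G" for u v
      using that by (simp add: arcs_G edges_def)
    then show "?L \<subseteq> ?R" by blast
    show "?R \<subseteq> ?L"
    proof
      fix x :: "'a + 'a set" assume "x \<in> ?R"
      then obtain u v where "x = Inr {u, v}" "u \<noteq> v" "{u, v} \<subseteq> V"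
        unfolding edges_def card_2_iff by blast
      then show "x \<in> ?L" by (auto simp: arcs_G)
    qed
  qed
  then show ?thesis by (simp add: subdivision_graph_def)
qed

lemma arcs_S: "parcs S =
    {(Inl u, Inr e) | u e. e \<in> edges \<and> u \<in> e} \<union> {(Inr e, Inl u) | u e. e \<in> edges \<and> u \<in> e}"
proof -
  \<comment> \<open>The arbitrary \<open>f\<close> lets one equivalence serve both orientations of
    the arcs.\<close>
  have "(\<exists>u v. x = f u {u, v} \<and> (u, v) \<in> parcs G) \<longleftrightarrow> (\<exists>u e. x = f u e \<and> e \<in> edges \<and> u \<in> e)"
    for x and f :: "'a \<Rightarrow> 'a set \<Rightarrow> 'b"
  proof
    assume "\<exists>u v. x = f u {u, v} \<and> (u, v) \<in> parcs G"
    then obtain u v where "x = f u {u, v}" "(u, v) \<in> parcs G" by blast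
    then show "\<exists>u e. x = f u e \<and> e \<in> edges \<and> u \<in> e"
      by (intro exI[of _ u] exI[of _ "{u,v}"]) (auto simp: arcs_G edges_def)
  next
    assume "\<exists>u e. x = f u e \<and> e \<in> edges \<and> u \<in> e"
    then obtain u e where *: "x = f u e" "e \<in> edges" "u \<in> e" by blast
    then obtain v where "e = {u, v}" "u \<noteq> v"
      unfolding edges_def card_2_iff by (auto simp: insert_commute)
    with * show "\<exists>u v. x = f u {u, v} \<and> (u, v) \<in> parcs G"
      by (auto simp: arcs_G edges_def)
  qed
  then show ?thesis
    unfolding subdivision_graph_def pair_pre_digraph.simps
    by (intro arg_cong2[where f = "(\<union>)"] Collect_cong)
qed

lemma vertex_set_props:
  assumes "x \<in> pverts S"
  shows "finite (vertex_set x)" "vertex_set x \<subseteq> V" "vertex_set x \<noteq> {}" "card (vertex_set x) \<le> 2"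
  using assms finite_V by (auto simp: verts_S edges_def finite_subset)

lemma inj_on_vertex_set: "inj_on vertex_set (pverts S)"
  by (auto simp: inj_on_def verts_S edges_def)

text \<open>Following an arc adds or removes a single element \<open>b\<close>. Hence no walk to
  \<open>y\<close> can be shorter than the symmetric difference.\<close>

lemma card_sym_diff_arc:
  assumes "(x, x') \<in> parcs S" "y \<in> pverts S"
  shows "card (sym_diff (vertex_set x) (vertex_set y)) \<le>
    card (sym_diff (vertex_set x') (vertex_set y)) + 1"
proof -
  have x: "x \<in> pverts S" "x' \<in> pverts S"
    using assms(1) by (auto simp: arcs_S verts_S edges_def)
  have "\<exists>b. sym_diff (vertex_set x) (vertex_set x') \<subseteq> {b}"
    using assms(1) by (auto simp: arcs_S edges_def card_2_iff)
  then obtain b where "sym_diff (vertex_set x) (vertex_set x') \<subseteq> {b}" ..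
  then have "sym_diff (vertex_set x) (vertex_set y) \<subseteq> insert b (sym_diff (vertex_set x') (vertex_set y))"
    by blast
  then have "card (sym_diff (vertex_set x) (vertex_set y)) \<le>
      card (insert b (sym_diff (vertex_set x') (vertex_set y)))"
    using vertex_set_props(1)[OF x(2)] vertex_set_props(1)[OF assms(2)] by (intro card_mono) auto
  also have "\<dots> \<le> card (sym_diff (vertex_set x') (vertex_set y)) + 1"
    by (metis card_insert_le_m1 Suc_eq_plus1 card_insert_if le_SucI le_refl card.infinite finite_insert zero_le)
  finally show ?thesis .
qed

text \<open>A greedy step towards \<open>y\<close>: a singleton gains an element of the target set,
  a pair loses an element outside it. Repeating it gives a walk as short as the lower bound
  allows.\<close>

lemma closer_neighbour:
  assumes x: "x \<in> pverts S" and y: "y \<in> pverts S" and "x \<noteq> y"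
  obtains x' where "(x, x') \<in> parcs S"
    "card (sym_diff (vertex_set x) (vertex_set y)) = card (sym_diff (vertex_set x') (vertex_set y)) + 1"
proof -
  note fin = vertex_set_props(1)[OF x] vertex_set_props(1)[OF y]
  have toggle: "card (sym_diff (vertex_set x) (vertex_set y)) = card (sym_diff X' (vertex_set y)) + 1"
    if "sym_diff (vertex_set x) (vertex_set y) = insert b (sym_diff X' (vertex_set y))"
      "b \<notin> sym_diff X' (vertex_set y)" for X' b
    using that fin by (metis Suc_eq_plus1 card_insert_disjoint finite_Diff finite_UnI finite_insert)
  show ?thesis
  proof (cases x)
    case (Inl u)
    have "\<exists>a \<in> vertex_set y. a \<noteq> u"
    proof (rule ccontr)
      assume "\<not> ?thesis"
      then have "vertex_set y = {u}" using vertex_set_props(3)[OF y] by auto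
      then show False using inj_on_vertex_set x y \<open>x \<noteq> y\<close> Inl by (metis inj_onD vertex_set.simps(1))
    qed
    then obtain a where a: "a \<in> vertex_set y" "a \<noteq> u" by blast
    have "{u, a} \<in> edges"
      using a Inl x vertex_set_props(2)[OF y] by (auto simp: edges_def verts_S)
    then show ?thesis
      using Inl a by (intro that[of "Inr {u, a}"] toggle[of a]) (auto simp: arcs_S)
  next
    case (Inr e)
    then have e: "e \<in> edges" using x by (auto simp: verts_S)
    \<comment> \<open>The target has at most two elements, so a pair contained in it would already
      be the target.\<close>
    have "\<not> e \<subseteq> vertex_set y"
    proof
      assume *: "e \<subseteq> vertex_set y"
      then have "e = vertex_set y"
        using e vertex_set_props(4)[OF y] fin by (intro card_seteq) (auto simp: edges_def)
      then show False using inj_on_vertex_set x y \<open>x \<noteq> y\<close> Inr by (metis inj_onD vertex_set.simps(2))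
    qed
    then obtain b where b: "b \<in> e" "b \<notin> vertex_set y" by blast
    then obtain a where a: "e = {a, b}" "a \<noteq> b"
      using e unfolding edges_def card_2_iff by (auto simp: insert_commute)
    then show ?thesis
      using Inr e b by (intro that[of "Inl a"] toggle[of b]) (auto simp: arcs_S)
  qed
qed

lemma graph_dist_S:
  assumes x: "x \<in> pverts S" and y: "y \<in> pverts S"
  shows "graph_dist S x y = real (card (sym_diff (vertex_set x) (vertex_set y)))"
proof -
  interpret S: pair_graph S by (rule pair_graph_S)
  have "\<exists>p. S.awalk x p y \<and> length p = card (sym_diff (vertex_set x) (vertex_set y))"
    using x
  proof (induction "card (sym_diff (vertex_set x) (vertex_set y))" arbitrary: x)
    case 0
    then have "vertex_set x = vertex_set y"
      using vertex_set_props(1)[OF y] vertex_set_props(1)[of x] by auto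
    then have "x = y" using inj_on_vertex_set 0 y by (meson inj_onD)
    then show ?case using 0 y by (intro exI[of _ "[]"]) (auto simp: S.awalk_Nil_iff)
  next
    case (Suc d)
    then have "x \<noteq> y" by auto
    then obtain x' where x': "(x, x') \<in> parcs S"
        "card (sym_diff (vertex_set x) (vertex_set y)) = card (sym_diff (vertex_set x') (vertex_set y)) + 1"
      using closer_neighbour Suc.prems y by blast
    then have "x' \<in> pverts S" by (auto simp: arcs_S verts_S edges_def)
    with Suc x' obtain p where "S.awalk x' p y" "length p = d" by fastforce
    with x' Suc show ?case by (intro exI[of _ "(x, x') # p"]) (auto simp: S.awalk_Cons_iff)
  qed
  then obtain p where p: "S.awalk x p y" "length p = card (sym_diff (vertex_set x) (vertex_set y))"
    by blast
  \<comment> \<open>The size of the symmetric difference is a potential that vanishes at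
    \<open>y\<close> and drops by at most one per arc.\<close>
  have "card (sym_diff (vertex_set x) (vertex_set y)) \<le> length q" if "S.awalk x q y" for q
    using that
  proof (induction q arbitrary: x)
    case Nil
    then show ?case by (auto simp: S.awalk_Nil_iff)
  next
    case (Cons e q)
    then have e: "e \<in> parcs S" "x = fst e" "S.awalk (snd e) q y"
      by (auto simp: S.awalk_Cons_iff)
    then show ?case
      using card_sym_diff_arc[of x "snd e" y] Cons.IH[of "snd e"] y by simp
  qed
  with p show ?thesis by (intro graph_dist_eqI[OF pair_graph_S, of x p y]) auto
qed

section \<open>Incidence sums over the vertices of the subdivision\<close>

lemma sum_verts_S: "(\<Sum>x\<in>pverts S. f x) = (\<Sum>v\<in>V. f (Inl v)) + (\<Sum>e\<in>edges. f (Inr e))"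
  unfolding verts_S using finite_V finite_edges
  by (subst sum.union_disjoint) (auto simp: sum.reindex)

lemma card_verts_S: "2 * card (pverts S) = (k + 1) * (k + 2)"
proof -
  have "card (pverts S) = k + 1 + ((k + 1) choose 2)"
    using sum_verts_S[of "\<lambda>_. 1::nat"] card_V card_edges by simp
  moreover have "2 * ((k + 1) choose 2) = (k + 1) * k"
    by (simp add: choose_two)
  ultimately show ?thesis by (simp add: algebra_simps)
qed

text \<open>The sets containing \<open>a\<close> are \<open>{a}\<close> and \<open>k\<close> pairs;
  only \<open>{a, b}\<close> contains two distinct \<open>a\<close> and \<open>b\<close>. The
  surplus \<open>k\<close> on the diagonal is what later yields the eigenvalue
  \<open>- 2 * k\<close>.\<close>

lemma sum_incident:
  assumes "a \<in> V" "b \<in> V"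
  shows "(\<Sum>x\<in>pverts S. of_bool (a \<in> vertex_set x) * of_bool (b \<in> vertex_set x)) =
    (if a = b then real k + 1 else 1)"
proof (cases "a = b")
  case True
  have "{e \<in> edges. a \<in> e} = (\<lambda>v. {a, v}) ` (V - {a})"
    using assms by (auto simp: edges_def card_2_iff)
  moreover have "inj_on (\<lambda>v. {a, v}) (V - {a})"
    by (auto simp: inj_on_def doubleton_eq_iff)
  ultimately have "card {e \<in> edges. a \<in> e} = k"
    using assms finite_V card_V by (simp add: card_image)
  moreover have "{v. v = a \<and> v \<in> V} = {a}" using assms by auto
  ultimately show ?thesis
    using True finite_V finite_edges
    by (simp add: sum_verts_S of_bool_conj[symmetric] Int_def conj_commute eq_commute[of b])
next
  case False
  have "{e \<in> edges. a \<in> e \<and> b \<in> e} = {{a, b}}"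
    using False assms by (auto simp: edges_def card_2_iff)
  moreover have "{v \<in> V. a = v \<and> b = v} = {}" using False by auto
  ultimately show ?thesis
    using False finite_V finite_edges
    by (simp add: sum_verts_S of_bool_conj[symmetric] Int_def)
qed

lemma card_vertex_set:
  assumes "x \<in> pverts S"
  shows "real (card (vertex_set x)) = (\<Sum>a\<in>V. of_bool (a \<in> vertex_set x))"
proof -
  have "{a \<in> V. a \<in> vertex_set x} = vertex_set x" using vertex_set_props(2)[OF assms] by auto
  then show ?thesis using finite_V by (simp add: of_bool_def sum.If_cases Int_def)
qed

lemma sum_incident_1:
  assumes "a \<in> V"
  shows "(\<Sum>x\<in>pverts S. of_bool (a \<in> vertex_set x)) = real k + 1"
  using sum_incident[OF assms assms] by (simp add: of_bool_conj[symmetric])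

text \<open>Expanding the size into indicators and swapping the sums leaves \<open>k + 1\<close>
  from \<open>b = a\<close> and \<open>1\<close> from each of the other \<open>k\<close>
  elements.\<close>

lemma sum_incident_card:
  assumes a: "a \<in> V"
  shows "(\<Sum>x\<in>pverts S. of_bool (a \<in> vertex_set x) * real (card (vertex_set x))) = 2 * real k + 1"
proof -
  have "(\<Sum>x\<in>pverts S. of_bool (a \<in> vertex_set x) * real (card (vertex_set x))) =
      (\<Sum>b\<in>V. \<Sum>x\<in>pverts S. of_bool (a \<in> vertex_set x) * of_bool (b \<in> vertex_set x))"
    by (subst sum.swap) (simp add: card_vertex_set sum_distrib_left)
  also have "\<dots> = (\<Sum>b\<in>V. (if a = b then real k else 0) + 1)"
    using a by (intro sum.cong) (auto simp: sum_incident)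
  also have "\<dots> = 2 * real k + 1"
    using a finite_V card_V by (simp add: sum.distrib)
  finally show ?thesis .
qed

text \<open>Double counting: each of the \<open>k + 1\<close> elements lies in \<open>k + 1\<close>
  sets.\<close>

lemma sum_card: "(\<Sum>x\<in>pverts S. real (card (vertex_set x))) = (real k + 1)\<^sup>2"
proof -
  have "(\<Sum>x\<in>pverts S. real (card (vertex_set x))) =
      (\<Sum>b\<in>V. \<Sum>x\<in>pverts S. of_bool (b \<in> vertex_set x))"
    by (subst sum.swap) (simp add: card_vertex_set)
  also have "\<dots> = (real k + 1)\<^sup>2"
    using card_V by (simp add: sum_incident_1 power2_eq_square)
  finally show ?thesis .
qed

section \<open>Low-rank factorization and the characteristic polynomial\<close>

text \<open>The size of the second set is absorbed into the sum over \<open>V\<close>, so that the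
  only other term depends on \<open>i\<close> alone. This is the shape of row \<open>i\<close> of
  \<open>U\<close> times column \<open>j\<close> of \<open>W\<close>.\<close>

lemma distance_matrix_S_nth:
  assumes "set vs = pverts S" "i < length vs" "j < length vs"
  shows "distance_matrix S vs $$ (i, j) =
    (\<Sum>a\<in>V. (1 - 2 * of_bool (a \<in> vertex_set (vs ! i))) * of_bool (a \<in> vertex_set (vs ! j)))
    + real (card (vertex_set (vs ! i)))"
proof -
  let ?X = "vertex_set (vs ! i)" and ?Y = "vertex_set (vs ! j)"
  have v: "vs ! i \<in> pverts S" "vs ! j \<in> pverts S"
    using assms nth_mem by metis+
  have "?X \<inter> ?Y = {a. a \<in> V \<and> a \<in> ?X \<and> a \<in> ?Y}"
    using vertex_set_props(2)[OF v(1)] by auto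
  then have "real (card (?X \<inter> ?Y)) = (\<Sum>a\<in>V. of_bool (a \<in> ?X) * of_bool (a \<in> ?Y))"
    using finite_V by (simp add: of_bool_conj[symmetric] Int_def)
  moreover have "distance_matrix S vs $$ (i, j) = real (card ?X) + real (card ?Y) - 2 * real (card (?X \<inter> ?Y))"
    using assms v vertex_set_props(1) by (simp add: distance_matrix_def graph_dist_S card_sym_diff_eq)
  ultimately show ?thesis
    by (simp only: card_vertex_set[OF v(2)] left_diff_distrib sum_subtractf sum_distrib_left mult.assoc) simp
qed

text \<open>The two factors on the left come from the two swaps of matrix products. They stay
  uncancelled so that the identity holds at every \<open>x\<close>, including their zeros.\<close>

lemma poly_char_poly_distance_matrix:
  assumes vs: "distinct vs" "set vs = pverts S"
  shows "x ^ (k + 2) * (x + 2 * real k)\<^sup>2 * poly (char_poly (distance_matrix S vs)) x =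
    x ^ length vs * (x + 2 * real k) ^ (k + 2) *
      ((x - (real k)\<^sup>2)\<^sup>2 - 1/2 * real k * ((real k)\<^sup>2 + 1) * (2 * real k + 1))"
proof -
  define N where "N = length vs"
  obtain ws where ws: "distinct ws" "set ws = V"
    using finite_distinct_list[OF finite_V] by blast
  have len_ws: "length ws = k + 1"
    using distinct_card[OF ws(1)] ws(2) card_V by simp
  have wsV: "ws ! j \<in> V" if "j \<le> k" for j
    using that ws(2) len_ws by (metis Suc_eq_plus1 le_imp_less_Suc nth_mem)
  have sum_vs: "(\<Sum>i=0..<N. f (vs ! i)) = (\<Sum>v\<in>pverts S. f v)" for f :: "_ \<Rightarrow> real"
    using sum.reindex_bij_betw[OF bij_betw_nth[OF vs(1), of "{0..<N}" "pverts S"]] vs(2)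
    by (auto simp: N_def atLeast0LessThan)
  have sum_ws: "(\<Sum>j=0..<k+1. f (ws ! j)) = (\<Sum>a\<in>V. f a)" for f :: "_ \<Rightarrow> real"
    using sum.reindex_bij_betw[OF bij_betw_nth[OF ws(1), of "{0..<k+1}" V]] ws(2) len_ws
    by (auto simp: atLeast0LessThan)
  \<comment> \<open>Indices up to \<open>k\<close> stand for the elements of \<open>V\<close>; index
    \<open>k + 1\<close> is the additional coordinate, a row of ones in \<open>W\<close> and the
    sizes in \<open>U\<close>.\<close>
  have split: "(\<Sum>j=0..<k+2. f j) = (\<Sum>j=0..<k+1. f j) + f (k + 1)" for f :: "nat \<Rightarrow> real"
    by simp
  have N: "real N = (real k + 1) * (real k + 2) / 2"
  proof -
    have "N = card (pverts S)"
      using distinct_card[OF vs(1)] vs(2) by (simp add: N_def)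
    then have "real (2 * N) = real ((k + 1) * (k + 2))"
      using card_verts_S by simp
    then show ?thesis by (simp add: algebra_simps)
  qed

  let ?inc = "\<lambda>i j. of_bool (ws ! j \<in> vertex_set (vs ! i)) :: real"
  define U where "U = mat N (k + 2)
    (\<lambda>(i, j). if j \<le> k then 1 - 2 * ?inc i j else real (card (vertex_set (vs ! i))))"
  define W where "W = mat (k + 2) N (\<lambda>(j, i). if j \<le> k then ?inc i j else 1)"
  \<comment> \<open>The columns of \<open>X\<close> indicate the two index blocks. The rows of
    \<open>Y\<close> are the rows of \<open>W * U + 2 * k\<close>, which agree within each block;
    the last entry of \<open>Y\<close> therefore contains the added \<open>2 * k\<close>.\<close>
  define X :: "real mat" where "X = mat (k + 2) 2 (\<lambda>(i, r). of_bool ((i \<le> k) = (r = 0)))"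
  define Y where "Y = mat 2 (k + 2) (\<lambda>(r, j).
    if r = 0 then (if j \<le> k then real k - 1 else 2 * real k + 1)
    else (if j \<le> k then real N - 2 * (real k + 1) else (real k + 1)\<^sup>2 + 2 * real k))"
  have carr: "U \<in> carrier_mat N (k + 2)" "W \<in> carrier_mat (k + 2) N"
      "X \<in> carrier_mat (k + 2) 2" "Y \<in> carrier_mat 2 (k + 2)"
      "distance_matrix S vs \<in> carrier_mat N N"
    by (auto simp: U_def W_def X_def Y_def distance_matrix_def N_def)

  have D: "distance_matrix S vs = U * W"
  proof (rule eq_matI)
    fix i j assume "i < dim_row (U * W)" "j < dim_col (U * W)"
    then have ij: "i < N" "j < N" using carr by auto
    have "(U * W) $$ (i, j) = (\<Sum>l=0..<k+2. U $$ (i, l) * W $$ (l, j))"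
      using ij carr by (simp add: scalar_prod_def)
    also have "\<dots> = (\<Sum>l=0..<k+1. (1 - 2 * ?inc i l) * ?inc j l) + real (card (vertex_set (vs ! i)))"
      using ij unfolding split by (simp add: U_def W_def)
    also have "\<dots> = distance_matrix S vs $$ (i, j)"
      using ij by (simp only: sum_ws[of "\<lambda>a. (1 - 2 * of_bool (a \<in> vertex_set (vs ! i))) *
          of_bool (a \<in> vertex_set (vs ! j))"] distance_matrix_S_nth[OF vs(2)] N_def)
    finally show "distance_matrix S vs $$ (i, j) = (U * W) $$ (i, j)" ..
  qed (use carr in auto)

  have shift: "x \<cdot>\<^sub>m 1\<^sub>m (k + 2) - W * U = (x + 2 * real k) \<cdot>\<^sub>m 1\<^sub>m (k + 2) - X * Y"
  proof (rule eq_matI)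
    fix j l assume "j < dim_row ((x + 2 * real k) \<cdot>\<^sub>m 1\<^sub>m (k + 2) - X * Y)"
      "l < dim_col ((x + 2 * real k) \<cdot>\<^sub>m 1\<^sub>m (k + 2) - X * Y)"
    then have jl: "j < k + 2" "l < k + 2" using carr by auto
    have XY: "(X * Y) $$ (j, l) = Y $$ (of_bool (k < j), l)"
      using jl carr by (auto simp: scalar_prod_def X_def numeral_2_eq_2)
    have "(W * U) $$ (j, l) = (\<Sum>i=0..<N. W $$ (j, i) * U $$ (i, l))"
      using jl carr by (simp add: scalar_prod_def)
    also have "\<dots> = Y $$ (of_bool (k < j), l) - 2 * real k * of_bool (j = l)"
    proof (cases "j \<le> k"; cases "l \<le> k")
      assume *: "j \<le> k" "l \<le> k"
      have "(\<Sum>i=0..<N. W $$ (j, i) * U $$ (i, l)) =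
          (\<Sum>i=0..<N. ?inc i j) - 2 * (\<Sum>i=0..<N. ?inc i j * ?inc i l)"
        using * jl unfolding sum_distrib_left sum_subtractf[symmetric]
        by (intro sum.cong) (auto simp: W_def U_def)
      also have "\<dots> = real k + 1 - 2 * (if ws ! j = ws ! l then real k + 1 else 1)"
        unfolding sum_vs[of "\<lambda>v. of_bool (ws ! j \<in> vertex_set v)"]
          sum_vs[of "\<lambda>v. of_bool (ws ! j \<in> vertex_set v) * of_bool (ws ! l \<in> vertex_set v)"]
        by (simp only: sum_incident_1 sum_incident wsV *)
      finally show ?thesis
        using * jl ws(1) len_ws by (simp add: Y_def nth_eq_iff_index_eq)
    next
      assume *: "j \<le> k" "\<not> l \<le> k"
      have "(\<Sum>i=0..<N. W $$ (j, i) * U $$ (i, l)) =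
          (\<Sum>i=0..<N. ?inc i j * real (card (vertex_set (vs ! i))))"
        using * jl by (intro sum.cong) (auto simp: W_def U_def)
      also have "\<dots> = 2 * real k + 1"
        unfolding sum_vs[of "\<lambda>v. of_bool (ws ! j \<in> vertex_set v) * real (card (vertex_set v))"]
        by (simp only: sum_incident_card wsV *)
      finally show ?thesis
        using * jl by (auto simp: Y_def)
    next
      assume *: "\<not> j \<le> k" "l \<le> k"
      have "(\<Sum>i=0..<N. W $$ (j, i) * U $$ (i, l)) = (\<Sum>i=0..<N. 1) - 2 * (\<Sum>i=0..<N. ?inc i l)"
        using * jl unfolding sum_distrib_left sum_subtractf[symmetric]
        by (intro sum.cong) (auto simp: W_def U_def)
      also have "\<dots> = real N - 2 * (real k + 1)"
        unfolding sum_vs[of "\<lambda>v. of_bool (ws ! l \<in> vertex_set v)"]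
        by (simp add: sum_incident_1 wsV * del: sum_of_bool_eq)
      finally show ?thesis
        using * jl by (auto simp: Y_def)
    next
      assume *: "\<not> j \<le> k" "\<not> l \<le> k"
      have "(\<Sum>i=0..<N. W $$ (j, i) * U $$ (i, l)) = (\<Sum>i=0..<N. real (card (vertex_set (vs ! i))))"
        using * jl by (intro sum.cong) (auto simp: W_def U_def)
      also have "\<dots> = (real k + 1)\<^sup>2"
        unfolding sum_vs[of "\<lambda>v. real (card (vertex_set v))"] by (rule sum_card)
      finally show ?thesis
        using * jl by (auto simp: Y_def)
    qed
    finally show "(x \<cdot>\<^sub>m 1\<^sub>m (k + 2) - W * U) $$ (j, l) =
        ((x + 2 * real k) \<cdot>\<^sub>m 1\<^sub>m (k + 2) - X * Y) $$ (j, l)"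
      using jl carr XY by (auto simp: algebra_simps)
  qed (use carr in auto)

  let ?y = "x + 2 * real k"
  \<comment> \<open>Each row of \<open>Y\<close> is constant on its first \<open>k + 1\<close>
    columns, so multiplying by \<open>X\<close> only adds up blocks.\<close>
  have YX: "(Y * X) $$ (r, s) = (if s = 0 then (real k + 1) * Y $$ (r, 0) else Y $$ (r, k + 1))"
    if "r < 2" "s < 2" for r s
  proof -
    have "(Y * X) $$ (r, s) = (\<Sum>l=0..<k+2. Y $$ (r, l) * X $$ (l, s))"
      using that carr by (simp add: scalar_prod_def)
    also have "\<dots> = (\<Sum>l=0..<k+1. Y $$ (r, 0) * of_bool (s = 0)) + Y $$ (r, k + 1) * of_bool (s \<noteq> 0)"
      unfolding split using that by (intro arg_cong2[where f = "(+)"] sum.cong) (auto simp: X_def Y_def)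
    finally show ?thesis by simp
  qed
  have Y: "Y $$ (0, 0) = real k - 1" "Y $$ (0, k + 1) = 2 * real k + 1"
      "Y $$ (1, 0) = real N - 2 * (real k + 1)" "Y $$ (1, k + 1) = (real k + 1)\<^sup>2 + 2 * real k"
    by (simp_all add: Y_def)
  have "det (?y \<cdot>\<^sub>m 1\<^sub>m 2 - Y * X) =
      (?y - (Y * X) $$ (0, 0)) * (?y - (Y * X) $$ (1, 1)) - (Y * X) $$ (0, 1) * (Y * X) $$ (1, 0)"
    using carr by (subst det_mat_2) (auto simp del: index_mult_mat(1) intro!: minus_carrier_mat)
  also have "\<dots> =
      (?y - (real k + 1) * (real k - 1)) * (?y - ((real k + 1)\<^sup>2 + 2 * real k))
      - (2 * real k + 1) * ((real k + 1) * (real N - 2 * (real k + 1)))"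
    using Y by (simp add: YX del: index_mult_mat(1))
  \<comment> \<open>The first two factors are \<open>(x - k^2) + (2 * k + 1)\<close> and
    \<open>(x - k^2) - (2 * k + 1)\<close>, and \<open>N - 2 * (k + 1)\<close> equals
    \<open>(k + 1) * (k - 2) / 2\<close>.\<close>
  also have "\<dots> = (x - (real k)\<^sup>2)\<^sup>2 - 1/2 * real k * ((real k)\<^sup>2 + 1) * (2 * real k + 1)"
    unfolding N by (simp add: field_simps power2_eq_square)
  finally have det2: "det (?y \<cdot>\<^sub>m 1\<^sub>m 2 - Y * X) =
      (x - (real k)\<^sup>2)\<^sup>2 - 1/2 * real k * ((real k)\<^sup>2 + 1) * (2 * real k + 1)" .

  \<comment> \<open>The first swap goes from size \<open>N\<close> to \<open>k + 2\<close>, the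
    second, after the shift by \<open>2 * k\<close>, from \<open>k + 2\<close> to 2.\<close>
  have "x ^ (k + 2) * poly (char_poly (distance_matrix S vs)) x =
      x ^ N * det (?y \<cdot>\<^sub>m 1\<^sub>m (k + 2) - X * Y)"
    using det_smult_one_minus_mult_swap[OF carr(1,2), of x] shift
    by (simp only: poly_char_poly[OF carr(5)[unfolded D]] D)
  moreover have "?y\<^sup>2 * det (?y \<cdot>\<^sub>m 1\<^sub>m (k + 2) - X * Y) = ?y ^ (k + 2) * det (?y \<cdot>\<^sub>m 1\<^sub>m 2 - Y * X)"
    by (rule det_smult_one_minus_mult_swap[OF carr(3,4)])
  ultimately have "?y\<^sup>2 * (x ^ (k + 2) * poly (char_poly (distance_matrix S vs)) x) =
      x ^ N * (?y ^ (k + 2) * det (?y \<cdot>\<^sub>m 1\<^sub>m 2 - Y * X))"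
    by (simp only: mult.left_commute[of "?y\<^sup>2"])
  then show ?thesis
    unfolding det2 N_def[symmetric] by (simp only: mult_ac)
qed

end

section \<open>Reading off the spectrum\<close>

theorem theorem3p4:
  fixes G :: "'a pair_pre_digraph" and k :: nat and vs :: "('a + 'a set) list"
  assumes "minimal_cage k 3 G"
    and "distinct vs" and "set vs = pverts (subdivision_graph G)"
  shows "eigenvalue_mset (distance_matrix (subdivision_graph G) vs) =
    {# (real k)^2 + sqrt (1/2 * real k * ((real k)^2 + 1) * (2 * real k + 1)),
       (real k)^2 - sqrt (1/2 * real k * ((real k)^2 + 1) * (2 * real k + 1)) #}
    + replicate_mset k (- 2 * real k)
    + replicate_mset (((k + 1) choose 2) - 1) 0"
proof -
  interpret complete_subdivision G k
    using minimal_cage_3_imp_complete[OF assms(1)] by unfold_locales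
  define d where "d = 1/2 * real k * ((real k)^2 + 1) * (2 * real k + 1)"
  define m where "m = ((k + 1) choose 2) - 1"
  define a where "a = (real k)\<^sup>2 + sqrt d"
  define b where "b = (real k)\<^sup>2 - sqrt d"
  let ?p = "char_poly (distance_matrix S vs)"
  let ?q = "[:0, 1:] ^ m * [:2 * real k, 1:] ^ k * ([:- a, 1:] * [:- b, 1:])"
  let ?r = "[:0, 1:] ^ (k + 2) * [:2 * real k, 1:]\<^sup>2"
  \<comment> \<open>The subtraction in \<open>m\<close> is not truncated since \<open>k\<close> is
    at least 2. With the \<open>k + 1\<close> old vertices this makes \<open>m\<close> the excess of
    the matrix size over \<open>k + 2\<close>.\<close>
  have "(k + 1) choose 2 = m + 1"
    using k by (simp add: m_def)
  then have len: "length vs = m + (k + 2)"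
    using sum_verts_S[of "\<lambda>_. 1::nat"] card_V card_edges distinct_card[OF assms(2)] assms(3)
    by simp
  have factor: "(x - (real k)\<^sup>2)\<^sup>2 - d = (x - a) * (x - b)" for x
  proof -
    have "(x - (real k)\<^sup>2)\<^sup>2 - (sqrt d)\<^sup>2 = (x - a) * (x - b)"
      unfolding a_def b_def by (simp add: power2_eq_square algebra_simps del: real_sqrt_mult_self)
    then show ?thesis by (simp add: d_def)
  qed
  have "poly (?r * ?p) x = poly (?r * ?q) x" for x
  proof -
    have "poly (?r * ?p) x = x ^ (k + 2) * (x + 2 * real k)\<^sup>2 * poly ?p x"
      by (simp add: add.commute)
    also have "\<dots> = x ^ (m + (k + 2)) * (x + 2 * real k) ^ (k + 2) * ((x - a) * (x - b))"
      using poly_char_poly_distance_matrix[OF assms(2,3)] by (simp only: d_def[symmetric] factor len)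
    also have "\<dots> = poly (?r * ?q) x"
      by (simp only: poly_mult poly_power poly_pCons poly_0 power_add) (simp add: ac_simps)
    finally show ?thesis .
  qed
  \<comment> \<open>Agreement at all reals is equality of polynomials, where the nonzero factor
    \<open>?r\<close> cancels even though it has real roots.\<close>
  then have "?r * ?p = ?r * ?q"
    by (intro iffD1[OF poly_eq_poly_eq_iff] ext)
  then have "?p = ?q"
    by (subst (asm) mult_left_cancel) auto
  then have "eigenvalue_mset (distance_matrix S vs) =
      {#a, b#} + replicate_mset k (- 2 * real k) + replicate_mset m 0"
    by (simp add: eigenvalue_mset_def proots_mult proots_power del: mult_pCons_left mult_pCons_right)
  then show ?thesis
    by (simp only: a_def b_def d_def m_def)
qed

end
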